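(* Let $k\ge 1$, $n\ge 1$ be integers and let $c\in\mathbb R$. The function $\mathbf p\mapsto\mathrm P_{\mathbf p}[L(\mathbf X)\ge c]$ is Schur-concave on $\mathcal P_k$, where $$L(\mathbf x)=\prod_{j=1}^k\frac{x_j!}{x_j^{x_j}},\qquad \mathbf x\in\mathcal S_{k,n}.$$
   Context: Let $\mathcal S_{k,n}=\{\mathbf x=(x_1,\dots,x_k): x_j\in\mathbb Z_{\ge 0},\ \sum_{j=1}^k x_j=n\}$ and $\mathcal P_k=\{\mathbf p=(p_1,\dots,p_k): 0\le p_j\le 1,\ \sum_{j=1}^k p_j=1\}$. For $\mathbf p\in\mathcal P_k$, $\mathrm P_{\mathbf p}$ denotes probability when $\mathbf X$ has the multinomial pmf $f_{\mathbf p}(\mathbf x)=\frac{n!}{\prod_{j=1}^k x_j!}\prod_{j=1}^k p_j^{x_j}$ on $\mathcal S_{k,n}$. The convention $0^0=1$ is used throughout. A vector $\mathbf a\in\mathbb R^k$ majorizes $\mathbf b\in\mathbb R^k$ if $\sum_j a_j=\sum_j b_j$ and, for each $m<k$, the sum of the $m$ largest coordinates of $\mathbf a$ is at least that of $\mathbf b$. A function $\phi$ is Schur-concave if $\phi(\mathbf a)\le\phi(\mathbf b)$ whenever $\mathbf a$ majorizes $\mathbf b$. *)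

theory Defs
  imports "HOL-Probability.Probability"
begin

text \<open>
  Vectors with $k$ coordinates are indexed by an arbitrary finite type, so that $k$ is the
  cardinality of that type; in particular $k \ge 1$.
\<close>

definition compositions :: "nat \<Rightarrow> (nat ^ 'k::finite) set" where
  "compositions n = {x. (\<Sum>j\<in>UNIV. x $ j) = n}"

definition prob_simplex :: "(real ^ 'k::finite) set" where
  "prob_simplex = {p. (\<forall>j. 0 \<le> p $ j \<and> p $ j \<le> 1) \<and> (\<Sum>j\<in>UNIV. p $ j) = 1}"

definition multinomial_density :: "nat \<Rightarrow> real ^ 'k::finite \<Rightarrow> nat ^ 'k \<Rightarrow> real" where
  "multinomial_density n p x =
     (if x \<in> compositions n
      then fact n / (\<Prod>j\<in>UNIV. fact (x $ j)) * (\<Prod>j\<in>UNIV. (p $ j) ^ (x $ j))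
      else 0)"

text \<open>Only meaningful for \<open>p \<in> prob_simplex\<close>; see \<open>pmf_multinomial\<close> below.\<close>

definition multinomial_pmf :: "nat \<Rightarrow> real ^ 'k::finite \<Rightarrow> (nat ^ 'k) pmf" where
  "multinomial_pmf n p = embed_pmf (multinomial_density n p)"

definition decreasing_coords :: "real ^ 'k::finite \<Rightarrow> real list" where
  "decreasing_coords a = rev (sorted_list_of_multiset (image_mset (\<lambda>j. a $ j) (mset_set UNIV)))"

definition majorizes :: "real ^ 'k::finite \<Rightarrow> real ^ 'k \<Rightarrow> bool" where
  "majorizes a b \<longleftrightarrow>
     (\<Sum>j\<in>UNIV. a $ j) = (\<Sum>j\<in>UNIV. b $ j) \<and>
     (\<forall>m < CARD('k). sum_list (take m (decreasing_coords a))
                     \<ge> sum_list (take m (decreasing_coords b)))"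

definition schur_concave_on :: "(real ^ 'k::finite) set \<Rightarrow> (real ^ 'k \<Rightarrow> real) \<Rightarrow> bool" where
  "schur_concave_on A \<phi> \<longleftrightarrow> (\<forall>a\<in>A. \<forall>b\<in>A. majorizes a b \<longrightarrow> \<phi> a \<le> \<phi> b)"

definition L_stat :: "nat ^ 'k::finite \<Rightarrow> real" where
  "L_stat x = (\<Prod>j\<in>UNIV. fact (x $ j) / real (x $ j) ^ (x $ j))"


text \<open>The multinomial theorem, which shows that the multinomial density sums to one.\<close>

lemma multinomial_sum_aux:
  fixes p :: "'a \<Rightarrow> real"
  assumes "finite A"
  shows "finite {x :: 'a \<Rightarrow> nat. (\<forall>j. j \<notin> A \<longrightarrow> x j = 0) \<and> sum x A = n} \<and>
    (\<Sum>x | (\<forall>j. j \<notin> A \<longrightarrow> x j = 0) \<and> sum x A = n. \<Prod>j\<in>A. p j ^ x j / fact (x j))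
      = sum p A ^ n / fact n"
  using assms
proof (induction A arbitrary: n)
  case empty
  have "{x :: 'a \<Rightarrow> nat. (\<forall>j. j \<notin> {} \<longrightarrow> x j = 0) \<and> sum x {} = n} = (if n = 0 then {\<lambda>_. 0} else {})"
    by auto
  then show ?case by (simp add: power_0_left)
next
  case (insert a A)
  define T where "T B n = {x :: 'a \<Rightarrow> nat. (\<forall>j. j \<notin> B \<longrightarrow> x j = 0) \<and> sum x B = n}" for B n
  define w where "w B x = (\<Prod>j\<in>B. p j ^ x j / fact (x j))" for B x
  have fin: "finite (T A m)" for m using insert.IH[of m] by (simp add: T_def)
  have IH: "(\<Sum>x\<in>T A m. w A x) = sum p A ^ m / fact m" for m
    using insert.IH[of m] by (simp add: T_def w_def)
  let ?S = "SIGMA i:{..n}. T A (n - i)"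
  let ?f = "\<lambda>(i, x). x(a := i)"
  have upd: "(\<Sum>j\<in>A. if j = a then i else x j) = sum x A" for x :: "'a \<Rightarrow> nat" and i
    using insert.hyps by (intro sum.cong) auto
  have wupd: "w A (x(a := i)) = w A x" for x i
    unfolding w_def using insert.hyps by (intro prod.cong) auto
  have bij: "bij_betw ?f ?S (T (insert a A) n)"
  proof (rule bij_betw_byWitness[where f' = "\<lambda>x. (x a, x(a := 0))"])
    show "\<forall>y\<in>?S. (\<lambda>x. (x a, x(a := 0))) (?f y) = y"
      using insert.hyps by (auto simp: T_def fun_eq_iff)
    show "\<forall>x\<in>T (insert a A) n. ?f (x a, x(a := 0)) = x" by auto
    show "?f ` ?S \<subseteq> T (insert a A) n"
      using insert.hyps by (auto simp: T_def upd)
    show "(\<lambda>x. (x a, x(a := 0))) ` T (insert a A) n \<subseteq> ?S"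
      using insert.hyps by (auto simp: T_def upd)
  qed
  have finS: "finite ?S" using fin by auto
  have f1: "finite (T (insert a A) n)"
    using bij_betw_finite[OF bij] finS by (rule iffD1)
  have "(\<Sum>x\<in>T (insert a A) n. w (insert a A) x) = (\<Sum>y\<in>?S. w (insert a A) (?f y))"
    by (rule sum.reindex_bij_betw[OF bij, symmetric])
  also have "\<dots> = (\<Sum>(i, x)\<in>?S. p a ^ i / fact i * w A x)"
  proof (intro sum.cong refl, clarify)
    fix i x
    have "w (insert a A) (x(a := i)) = p a ^ i / fact i * w A (x(a := i))"
      unfolding w_def using insert.hyps by simp
    then show "w (insert a A) (x(a := i)) = p a ^ i / fact i * w A x" by (simp add: wupd)
  qed
  also have "\<dots> = (\<Sum>i\<le>n. \<Sum>x\<in>T A (n - i). p a ^ i / fact i * w A x)"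
    using fin by (subst sum.Sigma) auto
  also have "\<dots> = (\<Sum>i\<le>n. p a ^ i / fact i * (sum p A ^ (n - i) / fact (n - i)))"
    by (simp only: sum_distrib_left[symmetric] IH)
  also have "\<dots> = (\<Sum>i\<le>n. real (n choose i) * p a ^ i * sum p A ^ (n - i)) / fact n"
    by (simp add: sum_divide_distrib binomial_fact field_simps)
  also have "\<dots> = (p a + sum p A) ^ n / fact n"
    by (simp add: binomial_ring)
  finally show ?case
    using f1 insert.hyps by (simp add: T_def w_def)
qed

lemma finite_compositions: "finite (compositions n :: (nat ^ 'k::finite) set)"
  and sum_multinomial_density:
    "p \<in> prob_simplex \<Longrightarrow> (\<Sum>x\<in>compositions n. multinomial_density n (p :: real ^ 'k) x) = 1"
proof -
  let ?T = "{x :: 'k \<Rightarrow> nat. (\<forall>j. j \<notin> UNIV \<longrightarrow> x j = 0) \<and> sum x UNIV = n}"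
  note aux = multinomial_sum_aux[of "UNIV :: 'k set" n, OF finite]
  have bij: "bij_betw (\<lambda>x :: 'k \<Rightarrow> nat. \<chi> j. x j) ?T (compositions n)"
    by (rule bij_betw_byWitness[where f' = "($)"]) (auto simp: compositions_def)
  show "finite (compositions n :: (nat ^ 'k) set)"
    using bij_betw_finite[OF bij] aux[THEN conjunct1] by (rule iffD1)
  assume p: "p \<in> prob_simplex"
  have "(\<Sum>x\<in>compositions n. multinomial_density n p x) =
      (\<Sum>x\<in>compositions n. fact n * (\<Prod>j\<in>UNIV. p $ j ^ x $ j / fact (x $ j)))"
    by (intro sum.cong) (auto simp: multinomial_density_def prod_dividef)
  also have "\<dots> = (\<Sum>x\<in>?T. fact n * (\<Prod>j\<in>UNIV. p $ j ^ x j / fact (x j)))"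
    by (subst sum.reindex_bij_betw[OF bij, symmetric]) simp
  also have "\<dots> = fact n * ((\<Sum>j\<in>UNIV. p $ j) ^ n / fact n)"
    by (simp only: sum_distrib_left[symmetric] aux[THEN conjunct2])
  finally show "(\<Sum>x\<in>compositions n. multinomial_density n p x) = 1"
    using p by (simp add: prob_simplex_def)
qed

lemma pmf_multinomial:
  fixes p :: "real ^ 'k::finite"
  assumes p: "p \<in> prob_simplex"
  shows "pmf (multinomial_pmf n p) x = multinomial_density n p x"
  unfolding multinomial_pmf_def
proof (rule pmf_embed_pmf)
  show nonneg: "0 \<le> multinomial_density n p x" for x
    using p by (auto simp: multinomial_density_def prob_simplex_def
        intro!: mult_nonneg_nonneg divide_nonneg_nonneg prod_nonneg)
  have "(\<integral>\<^sup>+x. ennreal (multinomial_density n p x) \<partial>count_space UNIV) =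
      (\<Sum>x\<in>compositions n. ennreal (multinomial_density n p x))"
    by (rule nn_integral_count_space')
       (auto simp: finite_compositions multinomial_density_def)
  also have "\<dots> = 1"
    using nonneg by (simp add: sum_multinomial_density[OF p])
  finally show "(\<integral>\<^sup>+x. ennreal (multinomial_density n p x) \<partial>count_space UNIV) = 1" .
qed

end

theory Submission
  imports Defs
begin

text \<open>
  Expectations of symmetric, transfer-monotone functions of a multinomial vector are
  Schur-concave: merging two coordinates reduces the claim to the binomial case, where the
  derivative of \<open>\<Sum>a. u a * (N choose a) * s ^ a * (M - s) ^ (N - a)\<close> in \<open>s\<close> is again a
  binomial sum, with the antisymmetric weights \<open>u (a + 1) - u a\<close>; pairing \<open>a\<close> with
  \<open>N - 1 - a\<close> gives its sign for \<open>2 * s \<le> M\<close>.  Majorization decomposes into finitely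
  many transfers between two coordinates.  The theorem follows since \<open>m! / m ^ m\<close> is
  log-concave in \<open>m\<close>, so that the indicator of \<open>{x. L x \<ge> c}\<close> is transfer-monotone.
\<close>

subsection \<open>Binomial sums with symmetric unimodal weights\<close>

text \<open>For \<open>s + t = 1\<close> this is the expectation of \<open>u\<close> under a
  binomial law with success probability \<open>s\<close>. Keeping \<open>s\<close> and
  \<open>t\<close> separate allows any total mass for the pair of coordinates.\<close>

definition binomial_sum :: "nat \<Rightarrow> (nat \<Rightarrow> real) \<Rightarrow> real \<Rightarrow> real \<Rightarrow> real" where
  "binomial_sum N u s t = (\<Sum>a\<le>N. u a * (real (N choose a) * s ^ a * t ^ (N - a)))"

lemma binomial_sum_0 [simp]: "binomial_sum 0 u s t = u 0"
  by (simp add: binomial_sum_def)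

text \<open>Pascal's rule, read as conditioning on one trial: a success has weight \<open>s\<close>
  and shifts \<open>u\<close>, a failure has weight \<open>t\<close>.\<close>

lemma binomial_sum_Suc:
  "binomial_sum (Suc N) u s t =
     s * binomial_sum N (\<lambda>a. u (Suc a)) s t + t * binomial_sum N u s t"
proof -
  have "binomial_sum (Suc N) u s t = u 0 * t ^ Suc N +
      (\<Sum>a\<le>N. u (Suc a) * (real (Suc N choose Suc a) * s ^ Suc a * t ^ (N - a)))"
    unfolding binomial_sum_def by (subst sum.atMost_Suc_shift) simp
  also have "\<dots> = (u 0 * t ^ Suc N + (\<Sum>a\<le>N. u (Suc a) * (real (N choose Suc a) * s ^ Suc a * t ^ (N - a))))
      + s * binomial_sum N (\<lambda>a. u (Suc a)) s t"
    unfolding binomial_sum_def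
    by (simp add: sum_distrib_left algebra_simps sum.distrib)
  also have "(\<Sum>a\<le>N. u (Suc a) * (real (N choose Suc a) * s ^ Suc a * t ^ (N - a)))
     = (\<Sum>a<N. u (Suc a) * (real (N choose Suc a) * s ^ Suc a * t ^ (N - a)))"
    by (intro sum.mono_neutral_right) auto
  also have "\<dots> = t * (\<Sum>a<N. u (Suc a) * (real (N choose Suc a) * s ^ Suc a * t ^ (N - Suc a)))"
    unfolding sum_distrib_left
  proof (intro sum.cong refl)
    fix a assume "a \<in> {..<N}"
    then have "N - a = Suc (N - Suc a)" by auto
    then show "u (Suc a) * (real (N choose Suc a) * s ^ Suc a * t ^ (N - a)) =
      t * (u (Suc a) * (real (N choose Suc a) * s ^ Suc a * t ^ (N - Suc a)))" by simp
  qed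
  also have "u 0 * t ^ Suc N + \<dots> = t * binomial_sum N u s t"
    unfolding binomial_sum_def lessThan_Suc_atMost[symmetric]
    by (subst sum.lessThan_Suc_shift) (simp add: algebra_simps)
  finally show ?thesis by simp
qed

lemma binomial_sum_diff:
  "binomial_sum N (\<lambda>a. u a - v a) s t = binomial_sum N u s t - binomial_sum N v s t"
  by (simp add: binomial_sum_def algebra_simps sum_subtractf)

lemma has_real_derivative_binomial_sum:
  "((\<lambda>s. binomial_sum (Suc N) u s (M - s)) has_real_derivative
     real (Suc N) * binomial_sum N (\<lambda>a. u (Suc a) - u a) s (M - s)) (at s)"
proof (induction N arbitrary: u)
  case 0
  show ?case
    by (auto simp: binomial_sum_Suc intro!: derivative_eq_intros)
next
  case (Suc N)
  show ?case
    \<comment> \<open>The product rule leaves one copy of the sum with differenced weights; the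
      induction hypothesis, used for \<open>u\<close> and for its shift, recombines into the other
      \<open>Suc N\<close> copies.\<close>
    unfolding binomial_sum_Suc[of "Suc N" u]
    by (rule derivative_eq_intros Suc.IH refl)+
       (simp add: binomial_sum_Suc binomial_sum_diff algebra_simps)
qed

lemma binomial_sum_reflect:
  "binomial_sum N (\<lambda>a. u (N - a)) s t = binomial_sum N u t s"
  unfolding binomial_sum_def
  by (rule sum.reindex_bij_witness[where i = "\<lambda>a. N - a" and j = "\<lambda>a. N - a"])
     (auto simp: binomial_symmetric[symmetric])

text \<open>By antisymmetry, exchanging \<open>s\<close> and \<open>t\<close> negates the sum. Twice
  the sum is therefore its difference from the exchanged one, and there the factor multiplying
  \<open>d a\<close> changes sign at the midpoint just as \<open>d\<close> does.\<close>

lemma binomial_sum_nonneg_of_antisymmetric: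
  assumes anti: "\<And>a. a \<le> N \<Longrightarrow> d (N - a) = - d a"
    and nonneg: "\<And>a. 2 * a < N \<Longrightarrow> 0 \<le> d a"
    and s: "0 \<le> s" "s \<le> t"
  shows "0 \<le> binomial_sum N d s t"
proof -
  have "binomial_sum N d t s = binomial_sum N (\<lambda>a. d (N - a)) s t"
    by (simp add: binomial_sum_reflect)
  also have "\<dots> = - binomial_sum N d s t"
    using anti by (auto simp: binomial_sum_def sum_negf[symmetric] intro!: sum.cong)
  finally have "2 * binomial_sum N d s t = binomial_sum N d s t - binomial_sum N d t s"
    by simp
  also have "\<dots> = (\<Sum>a\<le>N. real (N choose a) * (d a * (s ^ a * t ^ (N - a) - t ^ a * s ^ (N - a))))"
    by (simp add: binomial_sum_def sum_subtractf[symmetric] algebra_simps)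
  also have "\<dots> \<ge> 0"
  proof (intro sum_nonneg mult_nonneg_nonneg[OF of_nat_0_le_iff])
    \<comment> \<open>After the common factor \<open>(s * t) ^ a\<close> is split off, this is
      monotonicity of powers.\<close>
    have key: "s ^ b * t ^ a \<le> s ^ a * t ^ b" if "a \<le> b" for a b
    proof -
      have "s ^ b * t ^ a = (s * t) ^ a * s ^ (b - a)"
        using that by (simp add: power_mult_distrib power_add[symmetric] mult.commute mult.left_commute)
      also have "\<dots> \<le> (s * t) ^ a * t ^ (b - a)"
        using s by (intro mult_left_mono power_mono) auto
      also have "\<dots> = s ^ a * t ^ b"
        using that by (simp add: power_mult_distrib power_add[symmetric] mult.assoc)
      finally show ?thesis .
    qed
    fix a assume a: "a \<in> {..N}"
    consider "2 * a < N" | "2 * a = N" | "2 * (N - a) < N" 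
      using a by fastforce
    then show "0 \<le> d a * (s ^ a * t ^ (N - a) - t ^ a * s ^ (N - a))"
    proof cases
      case 1
      then show ?thesis using nonneg[OF 1] key[of a "N - a"]
        by (intro mult_nonneg_nonneg) (auto simp: mult.commute)
    next
      case 2
      then have "N - a = a" by simp
      then show ?thesis by simp
    next
      case 3
      then show ?thesis using nonneg[OF 3] anti[of a] a key[of "N - a" a]
        by (intro mult_nonpos_nonpos) (auto simp: mult.commute)
    qed
  qed
  finally show ?thesis by simp
qed

text \<open>With the total \<open>M\<close> fixed, the derivative in \<open>s\<close> is a binomial
  sum of the differences of \<open>u\<close>, which are antisymmetric because \<open>u\<close> is
  symmetric; it is nonnegative up to \<open>M / 2\<close>.\<close>

lemma binomial_sum_mono_of_unimodal:
  assumes sym: "\<And>a. a \<le> N \<Longrightarrow> u (N - a) = u a"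
    and mono: "\<And>a. Suc (2 * a) < N \<Longrightarrow> u a \<le> u (Suc a)"
    and s: "0 \<le> s" "s \<le> s'" "s' \<le> t'" "s + t = s' + t'"
  shows "binomial_sum N u s t \<le> binomial_sum N u s' t'"
proof (cases N)
  case 0
  then show ?thesis by simp
next
  case (Suc K)
  define M where "M = s + t"
  have "binomial_sum N u s (M - s) \<le> binomial_sum N u s' (M - s')"
  proof (rule DERIV_nonneg_imp_nondecreasing[OF s(2)])
    fix x assume x: "s \<le> x" "x \<le> s'"
    \<comment> \<open>Reflecting \<open>u\<close> about \<open>Suc K\<close> negates its differences
      under \<open>a\<close> to \<open>K - a\<close>. The bound \<open>x \<le> M - x\<close> comes
      from \<open>x \<le> s'\<close> and \<open>s' \<le> t'\<close>.\<close>
    have "0 \<le> binomial_sum K (\<lambda>a. u (Suc a) - u a) x (M - x)"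
    proof (rule binomial_sum_nonneg_of_antisymmetric)
      fix a assume a: "a \<le> K"
      have "u (Suc (K - a)) = u a" "u (K - a) = u (Suc a)"
        using sym[of a] sym[of "Suc a"] a Suc by (auto simp: Suc_diff_le)
      then show "u (Suc (K - a)) - u (K - a) = - (u (Suc a) - u a)" by simp
    qed (use mono Suc x s M_def in auto)
    then show "\<exists>y. ((\<lambda>s. binomial_sum N u s (M - s)) has_real_derivative y) (at x) \<and> 0 \<le> y"
      unfolding Suc using has_real_derivative_binomial_sum[of K u M x]
      by (meson mult_nonneg_nonneg of_nat_0_le_iff)
  qed
  moreover have "M - s = t" "M - s' = t'" using s by (auto simp: M_def)
  ultimately show ?thesis by simp
qed

subsection \<open>Schur-concavity of multinomial expectations\<close>

text \<open>A plain finite sum, meaningful for every vector \<open>p\<close>; on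
  \<open>prob_simplex\<close> it is the expectation of \<open>\<phi>\<close>.\<close>

definition multinomial_expectation ::
    "nat \<Rightarrow> (nat ^ 'k \<Rightarrow> real) \<Rightarrow> real ^ 'k::finite \<Rightarrow> real" where
  "multinomial_expectation n \<phi> p = (\<Sum>x\<in>compositions n. \<phi> x * multinomial_density n p x)"

definition permute_vec :: "('k \<Rightarrow> 'k) \<Rightarrow> 'a ^ 'k::finite \<Rightarrow> 'a ^ 'k" where
  "permute_vec \<pi> x = (\<chi> l. x $ \<pi> l)"

definition symmetric_fun :: "('a ^ 'k::finite \<Rightarrow> real) \<Rightarrow> bool" where
  "symmetric_fun \<phi> \<longleftrightarrow> (\<forall>\<pi> x. bij \<pi> \<longrightarrow> \<phi> (permute_vec \<pi> x) = \<phi> x)"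

definition set_pair :: "'k \<Rightarrow> 'k \<Rightarrow> 'a ^ 'k::finite \<Rightarrow> 'a \<Rightarrow> 'a \<Rightarrow> 'a ^ 'k" where
  "set_pair i j x a b = (\<chi> l. if l = i then a else if l = j then b else x $ l)"

text \<open>The strict inequality keeps the \<open>nat\<close> subtraction genuine. When the entries
  differ by one, the move merely swaps them.\<close>

definition transfer_mono :: "(nat ^ 'k::finite \<Rightarrow> real) \<Rightarrow> bool" where
  "transfer_mono \<phi> \<longleftrightarrow> (\<forall>x i j. i \<noteq> j \<longrightarrow> x $ i < x $ j \<longrightarrow>
     \<phi> x \<le> \<phi> (set_pair i j x (Suc (x $ i)) (x $ j - 1)))"

section \<open>Modifying two coordinates of a vector\<close>

lemma set_pair_nth [simp]:
  "set_pair i j x a b $ i = a"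
  "i \<noteq> j \<Longrightarrow> set_pair i j x a b $ j = b"
  "l \<noteq> i \<Longrightarrow> l \<noteq> j \<Longrightarrow> set_pair i j x a b $ l = x $ l"
  by (auto simp: set_pair_def)

lemma set_pair_set_pair [simp]:
  "set_pair i j (set_pair i j x a b) a' b' = set_pair i j x a' b'"
  by (auto simp: set_pair_def vec_eq_iff)

lemma set_pair_swap:
  assumes "i \<noteq> j"
  shows "set_pair i j x b a = permute_vec (Transposition.transpose i j) (set_pair i j x a b)"
  using assms by (auto simp: set_pair_def permute_vec_def vec_eq_iff Transposition.transpose_def)

text \<open>Stated in the locale so that sums and products are both covered.\<close>

lemma (in comm_monoid_set) remove_pair:
  assumes "finite A" "i \<in> A" "j \<in> A" "i \<noteq> j"
  shows "F g A = g i \<^bold>* (g j \<^bold>* F g (A - {i, j}))"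
proof -
  have "F g A = g i \<^bold>* F g (A - {i})" using assms by (intro remove) auto
  also have "F g (A - {i}) = g j \<^bold>* F g (A - {i} - {j})" using assms by (intro remove) auto
  also have "A - {i} - {j} = A - {i, j}" by auto
  finally show ?thesis .
qed

section \<open>Invariance under permutations of the coordinates\<close>

lemma bij_betw_permute_vec_compositions:
  assumes "bij \<pi>"
  shows "bij_betw (permute_vec \<pi>) (compositions n) (compositions n)"
proof (rule bij_betw_byWitness[where f' = "permute_vec (inv \<pi>)"])
  have *: "permute_vec \<sigma> x \<in> compositions n" if "bij \<sigma>" "x \<in> compositions n" for \<sigma> :: "'a \<Rightarrow> 'a" and x
    using that sum.reindex_bij_betw[OF that(1), of "\<lambda>l. x $ l"]
    by (simp add: compositions_def permute_vec_def)
  show "permute_vec \<pi> ` compositions n \<subseteq> compositions n"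
    using *[OF assms] by auto
  show "permute_vec (inv \<pi>) ` compositions n \<subseteq> compositions n"
    using *[OF bij_imp_bij_inv[OF assms]] by auto
qed (use assms in \<open>auto simp: permute_vec_def vec_eq_iff bij_is_inj bij_is_surj surj_f_inv_f\<close>)

lemma multinomial_density_permute:
  assumes "bij \<pi>"
  shows "multinomial_density n (permute_vec \<pi> p) (permute_vec \<pi> x) = multinomial_density n p x"
proof -
  have "(\<Prod>j\<in>UNIV. fact (x $ \<pi> j)) = (\<Prod>j\<in>UNIV. (fact (x $ j) :: real))"
    by (rule prod.reindex_bij_betw[OF assms])
  moreover have "(\<Prod>j\<in>UNIV. p $ \<pi> j ^ x $ \<pi> j) = (\<Prod>j\<in>UNIV. p $ j ^ x $ j)"
    by (rule prod.reindex_bij_betw[OF assms])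
  moreover have "(\<Sum>j\<in>UNIV. x $ \<pi> j) = (\<Sum>j\<in>UNIV. x $ j)"
    by (rule sum.reindex_bij_betw[OF assms])
  ultimately show ?thesis
    by (simp add: multinomial_density_def permute_vec_def compositions_def)
qed

lemma symmetric_fun_multinomial_expectation:
  assumes "symmetric_fun \<phi>"
  shows "symmetric_fun (multinomial_expectation n \<phi>)"
  unfolding symmetric_fun_def
proof (intro allI impI)
  fix \<pi> :: "'a \<Rightarrow> 'a" and p assume "bij \<pi>"
  with assms show "multinomial_expectation n \<phi> (permute_vec \<pi> p) = multinomial_expectation n \<phi> p"
    unfolding multinomial_expectation_def
    by (subst sum.reindex_bij_betw[OF bij_betw_permute_vec_compositions, symmetric, of \<pi>])
       (auto simp: multinomial_density_permute symmetric_fun_def)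
qed

text \<open>Here \<open>y\<close> holds the merged count \<open>N\<close> of the pair at
  \<open>i\<close> and zero at \<open>j\<close>. As \<open>1 / (a! (N - a)!)\<close> equals
  \<open>(N choose a) / N!\<close>, the density splits into a factor independent of
  \<open>a\<close>, \<open>p $ i\<close> and \<open>p $ j\<close>, and a binomial term.\<close>

lemma multinomial_density_set_pair:
  fixes p :: "real ^ 'k::finite"
  assumes ij: "i \<noteq> j" and y: "y \<in> compositions n" "y $ j = 0" and a: "a \<le> y $ i"
  shows "multinomial_density n p (set_pair i j y a (y $ i - a)) =
    fact n / (fact (y $ i) * (\<Prod>l\<in>UNIV - {i, j}. fact (y $ l))) * (\<Prod>l\<in>UNIV - {i, j}. p $ l ^ y $ l)
      * (real (y $ i choose a) * p $ i ^ a * p $ j ^ (y $ i - a))"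
proof -
  let ?x = "set_pair i j y a (y $ i - a)"
  have rest: "(\<Prod>l\<in>UNIV - {i, j}. fact (?x $ l)) = (\<Prod>l\<in>UNIV - {i, j}. (fact (y $ l) :: real))"
    "(\<Prod>l\<in>UNIV - {i, j}. p $ l ^ (?x $ l)) = (\<Prod>l\<in>UNIV - {i, j}. p $ l ^ y $ l)"
    "(\<Sum>l\<in>UNIV - {i, j}. ?x $ l) = (\<Sum>l\<in>UNIV - {i, j}. y $ l)"
    by (auto intro!: prod.cong sum.cong)
  note rp = sum.remove_pair[OF finite_class.finite_UNIV UNIV_I UNIV_I ij]
    prod.remove_pair[OF finite_class.finite_UNIV UNIV_I UNIV_I ij]
  have "?x \<in> compositions n"
    using y a ij rest(3) by (simp add: compositions_def rp)
  then show ?thesis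
    using ij a rest by (simp add: multinomial_density_def rp binomial_fact mult_ac)
qed

text \<open>Outcomes are grouped by their image under \<open>merge\<close>. Each group contributes a
  nonnegative constant, unchanged by the transfer, times a binomial sum with symmetric unimodal
  weights.\<close>

lemma multinomial_expectation_transfer:
  fixes p :: "real ^ 'k::finite"
  assumes \<phi>: "symmetric_fun \<phi>" "transfer_mono \<phi>" and ij: "i \<noteq> j"
    and p: "\<And>l. 0 \<le> p $ l" and \<delta>: "0 \<le> \<delta>" "p $ i + \<delta> \<le> p $ j - \<delta>"
  shows "multinomial_expectation n \<phi> p
    \<le> multinomial_expectation n \<phi> (set_pair i j p (p $ i + \<delta>) (p $ j - \<delta>))"
proof -
  define q where "q = set_pair i j p (p $ i + \<delta>) (p $ j - \<delta>)"
  define merge where "merge x = set_pair i j x (x $ i + x $ j) 0" for x :: "nat ^ 'k"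
  define C :: "(nat ^ 'k) set" where "C = compositions n"
  note rp = sum.remove_pair[OF finite_class.finite_UNIV UNIV_I UNIV_I ij]
  have merge_rest: "(\<Sum>l\<in>UNIV - {i, j}. merge x $ l) = (\<Sum>l\<in>UNIV - {i, j}. x $ l)" for x
    by (auto simp: merge_def intro!: sum.cong)
  have set_rest: "(\<Sum>l\<in>UNIV - {i, j}. set_pair i j x a b $ l) = (\<Sum>l\<in>UNIV - {i, j}. x $ l)"
    for x :: "nat ^ 'k" and a b
    by (auto intro!: sum.cong)
  have group: "multinomial_expectation n \<phi> r =
     (\<Sum>y\<in>merge ` C. \<Sum>x | x \<in> C \<and> merge x = y. \<phi> x * multinomial_density n r x)" for r
    unfolding multinomial_expectation_def C_def
    by (rule sum.image_gen[OF finite_compositions])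
  have fibre: "(\<Sum>x | x \<in> C \<and> merge x = y. \<phi> x * multinomial_density n r x) =
      fact n / (fact (y $ i) * (\<Prod>l\<in>UNIV - {i, j}. fact (y $ l))) * (\<Prod>l\<in>UNIV - {i, j}. r $ l ^ y $ l)
      * binomial_sum (y $ i) (\<lambda>a. \<phi> (set_pair i j y a (y $ i - a))) (r $ i) (r $ j)"
    (is "_ = ?K * _")
    if "y \<in> merge ` C" for y r
  proof -
    have y: "y \<in> compositions n" "y $ j = 0"
      using that ij merge_rest by (auto simp: C_def compositions_def rp) (auto simp: merge_def)
    \<comment> \<open>A point of the fibre is determined by the share \<open>a\<close> of the merged
      count given to coordinate \<open>i\<close>.\<close>
    have bij: "bij_betw (\<lambda>a. set_pair i j y a (y $ i - a)) {..y $ i} {x. x \<in> C \<and> merge x = y}"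
    proof (rule bij_betw_byWitness[where f' = "\<lambda>x. x $ i"])
      show "\<forall>x\<in>{x. x \<in> C \<and> merge x = y}. set_pair i j y (x $ i) (y $ i - x $ i) = x"
        using ij by (auto simp: merge_def vec_eq_iff set_pair_def)
      show "(\<lambda>a. set_pair i j y a (y $ i - a)) ` {..y $ i} \<subseteq> {x. x \<in> C \<and> merge x = y}"
        using ij y set_rest
        by (auto simp: C_def compositions_def rp) (auto simp: merge_def vec_eq_iff set_pair_def)
      show "(\<lambda>x. x $ i) ` {x. x \<in> C \<and> merge x = y} \<subseteq> {..y $ i}"
        by (auto simp: merge_def)
    qed auto
    have "(\<Sum>x | x \<in> C \<and> merge x = y. \<phi> x * multinomial_density n r x) =
      (\<Sum>a\<le>y $ i. \<phi> (set_pair i j y a (y $ i - a)) *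
         multinomial_density n r (set_pair i j y a (y $ i - a)))"
      by (rule sum.reindex_bij_betw[OF bij, symmetric])
    also have "\<dots> = (\<Sum>a\<le>y $ i. ?K * (\<phi> (set_pair i j y a (y $ i - a)) *
         (real (y $ i choose a) * r $ i ^ a * r $ j ^ (y $ i - a))))"
      using ij y by (intro sum.cong) (auto simp: multinomial_density_set_pair)
    also have "\<dots> = ?K * binomial_sum (y $ i) (\<lambda>a. \<phi> (set_pair i j y a (y $ i - a))) (r $ i) (r $ j)"
      by (simp only: binomial_sum_def sum_distrib_left)
    finally show ?thesis .
  qed
  have uni: "binomial_sum (y $ i) (\<lambda>a. \<phi> (set_pair i j y a (y $ i - a))) (p $ i) (p $ j)
    \<le> binomial_sum (y $ i) (\<lambda>a. \<phi> (set_pair i j y a (y $ i - a))) (q $ i) (q $ j)" for y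
  \<comment> \<open>Symmetry of the weights is invariance of \<open>\<phi>\<close> under swapping
    \<open>i\<close> and \<open>j\<close>; their increase in the lower half is
    \<open>transfer_mono\<close>, one unit moving from \<open>j\<close> to \<open>i\<close>.\<close>
  proof (rule binomial_sum_mono_of_unimodal)
    fix a assume a: "a \<le> y $ i"
    show "\<phi> (set_pair i j y (y $ i - a) (y $ i - (y $ i - a))) = \<phi> (set_pair i j y a (y $ i - a))"
      using a set_pair_swap[OF ij, of y "y $ i - a" a] \<phi>(1)
      by (simp add: symmetric_fun_def)
  next
    fix a assume a: "Suc (2 * a) < y $ i"
    let ?x = "set_pair i j y a (y $ i - a)"
    have "\<phi> ?x \<le> \<phi> (set_pair i j ?x (Suc (?x $ i)) (?x $ j - 1))"
      using \<phi>(2)[unfolded transfer_mono_def, rule_format, OF ij, of ?x] ij a by simp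
    then show "\<phi> ?x \<le> \<phi> (set_pair i j y (Suc a) (y $ i - Suc a))"
      using ij by simp
  qed (use p \<delta> ij in \<open>auto simp: q_def\<close>)
  have "multinomial_expectation n \<phi> p \<le> multinomial_expectation n \<phi> q"
    unfolding group
  proof (rule sum_mono)
    fix y assume y: "y \<in> merge ` C"
    have "(\<Prod>l\<in>UNIV - {i, j}. q $ l ^ y $ l) = (\<Prod>l\<in>UNIV - {i, j}. p $ l ^ y $ l)"
      by (auto simp: q_def intro!: prod.cong)
    then show "(\<Sum>x | x \<in> C \<and> merge x = y. \<phi> x * multinomial_density n p x)
      \<le> (\<Sum>x | x \<in> C \<and> merge x = y. \<phi> x * multinomial_density n q x)"
      unfolding fibre[OF y] using uni p
      by (simp only:) (intro mult_left_mono mult_nonneg_nonneg divide_nonneg_nonneg prod_nonneg; simp)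
  qed
  then show ?thesis by (simp add: q_def)
qed

subsection \<open>Majorization and transfers\<close>

text \<open>Induction on the number of entries where the sequences differ: each transfer makes at
  least one more entry agree. Order is imposed on \<open>\<beta>\<close> alone, so intermediate
  sequences are never re-sorted. The premise \<open>cong\<close> says that \<open>F\<close> takes
  the value \<open>F \<beta>\<close> at any sequence agreeing with \<open>\<beta>\<close> below
  \<open>K\<close>.\<close>

lemma partial_sums_le_imp_transfer_le:
  fixes \<alpha> \<beta> :: "nat \<Rightarrow> real" and F :: "(nat \<Rightarrow> real) \<Rightarrow> real"
  assumes antitone: "\<And>i j. i \<le> j \<Longrightarrow> j < K \<Longrightarrow> \<beta> j \<le> \<beta> i"
    and cong: "\<And>\<alpha>. (\<And>l. l < K \<Longrightarrow> \<alpha> l = \<beta> l) \<Longrightarrow> F \<alpha> = F \<beta>"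
    and transfer: "\<And>\<alpha> i j \<delta>. (\<And>l. l < K \<Longrightarrow> 0 \<le> \<alpha> l) \<Longrightarrow> i < j \<Longrightarrow> j < K \<Longrightarrow> 0 \<le> \<delta> \<Longrightarrow>
       \<alpha> j + \<delta> \<le> \<alpha> i - \<delta> \<Longrightarrow> F \<alpha> \<le> F (\<alpha>(i := \<alpha> i - \<delta>, j := \<alpha> j + \<delta>))"
    and nonneg: "\<And>l. l < K \<Longrightarrow> 0 \<le> \<alpha> l"
    and partial: "\<And>m. m \<le> K \<Longrightarrow> sum \<beta> {..<m} \<le> sum \<alpha> {..<m}"
    and total: "sum \<beta> {..<K} = sum \<alpha> {..<K}"
  shows "F \<alpha> \<le> F \<beta>"
  using nonneg partial total
proof (induction "card {l. l < K \<and> \<alpha> l \<noteq> \<beta> l}" arbitrary: \<alpha> rule: less_induct)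
  case less
  show ?case
  proof (cases "\<forall>l<K. \<beta> l \<le> \<alpha> l")
    case True
    have "(\<Sum>l<K. \<alpha> l - \<beta> l) = 0" using less.prems(3) by (simp add: sum_subtractf)
    then have "\<forall>l\<in>{..<K}. \<alpha> l - \<beta> l = 0"
      by (subst (asm) sum_nonneg_eq_0_iff) (use True in auto)
    then have "F \<alpha> = F \<beta>" by (intro cong) auto
    then show ?thesis by simp
  next
    case False
    \<comment> \<open>The first deficit. Without a strict surplus before it, the partial sum through
      \<open>j\<close> would fall below that of \<open>\<beta>\<close>.\<close>
    define j where "j = (LEAST l. l < K \<and> \<alpha> l < \<beta> l)"
    have "j < K \<and> \<alpha> j < \<beta> j"
      unfolding j_def by (rule LeastI_ex) (use False in force)
    then have j: "j < K" "\<alpha> j < \<beta> j" by auto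
    have below: "\<beta> l \<le> \<alpha> l" if "l < j" for l
      using not_less_Least[of l "\<lambda>l. l < K \<and> \<alpha> l < \<beta> l"] that j by (force simp: j_def)
    have "\<exists>i<j. \<beta> i < \<alpha> i"
    proof (rule ccontr)
      assume "\<not> ?thesis"
      then have "sum \<alpha> {..<j} \<le> sum \<beta> {..<j}" by (intro sum_mono) force
      with j less.prems(2)[of "Suc j"] show False by auto
    qed
    then obtain i where i: "i < j" "\<beta> i < \<alpha> i" by auto
    \<comment> \<open>The largest amount that overshoots neither target, so one of the two entries
      becomes exact.\<close>
    define \<delta> where "\<delta> = min (\<alpha> i - \<beta> i) (\<beta> j - \<alpha> j)"
    define \<alpha>' where "\<alpha>' = \<alpha>(i := \<alpha> i - \<delta>, j := \<alpha> j + \<delta>)"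
    have \<delta>: "0 \<le> \<delta>" "\<delta> \<le> \<alpha> i - \<beta> i" "\<delta> \<le> \<beta> j - \<alpha> j" using i j by (auto simp: \<delta>_def)
    \<comment> \<open>The targets lie in between: \<open>\<alpha> j + \<delta> \<le> \<beta> j \<le>
      \<beta> i \<le> \<alpha> i - \<delta>\<close>.\<close>
    have ord: "\<alpha> j + \<delta> \<le> \<alpha> i - \<delta>" using antitone[of i j] \<delta> i j by auto
    have sum': "sum \<alpha>' {..<m} = sum \<alpha> {..<m} - (if i < m then \<delta> else 0) + (if j < m then \<delta> else 0)" for m
    proof -
      have "sum \<alpha>' {..<m} = (\<Sum>l<m. \<alpha> l - (if l = i then \<delta> else 0) + (if l = j then \<delta> else 0))"
        using i by (intro sum.cong) (auto simp: \<alpha>'_def)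
      also have "\<dots> = sum \<alpha> {..<m} - (\<Sum>l<m. if l = i then \<delta> else 0) + (\<Sum>l<m. if l = j then \<delta> else 0)"
        by (simp add: sum.distrib sum_subtractf)
      finally show ?thesis by simp
    qed
    have "F \<alpha> \<le> F \<alpha>'"
      unfolding \<alpha>'_def by (rule transfer) (use less.prems i j \<delta> ord in auto)
    also have "F \<alpha>' \<le> F \<beta>"
    proof (rule less.hyps)
      have "{l. l < K \<and> \<alpha>' l \<noteq> \<beta> l} \<subset> {l. l < K \<and> \<alpha> l \<noteq> \<beta> l}"
      proof
        show "{l. l < K \<and> \<alpha>' l \<noteq> \<beta> l} \<subseteq> {l. l < K \<and> \<alpha> l \<noteq> \<beta> l}"
          using i j by (auto simp: \<alpha>'_def)
        have "\<alpha>' i = \<beta> i \<or> \<alpha>' j = \<beta> j" using i by (auto simp: \<alpha>'_def \<delta>_def min_def)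
        then show "{l. l < K \<and> \<alpha>' l \<noteq> \<beta> l} \<noteq> {l. l < K \<and> \<alpha> l \<noteq> \<beta> l}"
          using i j by fastforce
      qed
      then show "card {l. l < K \<and> \<alpha>' l \<noteq> \<beta> l} < card {l. l < K \<and> \<alpha> l \<noteq> \<beta> l}"
        by (intro psubset_card_mono) auto
      show "0 \<le> \<alpha>' l" if "l < K" for l
        using that less.prems(1)[of l] less.prems(1)[of j] j \<delta> ord by (auto simp: \<alpha>'_def)
      show "sum \<beta> {..<K} = sum \<alpha>' {..<K}" using i j less.prems(3) by (simp add: sum')
      fix m assume m: "m \<le> K"
      show "sum \<beta> {..<m} \<le> sum \<alpha>' {..<m}"
      \<comment> \<open>Only these partial sums drop, by \<open>\<delta>\<close>. All terms
        \<open>\<alpha> l - \<beta> l\<close> before \<open>j\<close> are nonnegative, and the one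
        at \<open>i\<close> already covers \<open>\<delta>\<close>.\<close>
      proof (cases "i < m \<and> m \<le> j")
        case True
        have "\<alpha> i - \<beta> i \<le> (\<Sum>l<m. \<alpha> l - \<beta> l)"
          using True below by (intro member_le_sum) auto
        then show ?thesis using True \<delta> by (simp add: sum' sum_subtractf)
      next
        case False
        then show ?thesis using less.prems(2)[OF m] i by (auto simp: sum')
      qed
    qed
    finally show ?thesis .
  qed
qed

text \<open>The sorted list forgets which coordinate each value came from; \<open>e\<close> recovers
  a ranking, ties broken somehow, and turns prefix sums into sums over initial segments of
  indices.\<close>

lemma decreasing_coords_enumeration:
  fixes a :: "real ^ 'k::finite"
  obtains e where "bij_betw e {..<CARD('k)} UNIV"
    and "decreasing_coords a = map (\<lambda>i. a $ e i) [0..<CARD('k)]"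
    and "\<And>i j. i \<le> j \<Longrightarrow> j < CARD('k) \<Longrightarrow> a $ e j \<le> a $ e i"
proof -
  obtain xs :: "'k list" where xs: "set xs = UNIV" "distinct xs"
    using finite_distinct_list[OF finite_class.finite_UNIV] by blast
  define ys where "ys = rev (sort_key (($) a) xs)"
  have ys: "set ys = UNIV" "distinct ys" using xs by (auto simp: ys_def)
  then have len: "length ys = CARD('k)" using distinct_card by metis
  have "mset_set UNIV = mset ys" using ys by (metis mset_set_set)
  then have "decreasing_coords a = rev (sort (map (($) a) ys))"
    by (simp add: decreasing_coords_def flip: mset_map)
  also have "sort (map (($) a) ys) = rev (map (($) a) ys)"
    by (rule properties_for_sort) (auto simp: ys_def rev_map)
  finally have dec: "decreasing_coords a = map (($) a) ys" by simp
  show ?thesis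
  proof
    show "bij_betw ((!) ys) {..<CARD('k)} UNIV"
      using bij_betw_nth[OF ys(2)] ys(1) len by auto
    show "decreasing_coords a = map (\<lambda>i. a $ (ys ! i)) [0..<CARD('k)]"
      unfolding dec len[symmetric] by (rule nth_equalityI) auto
    fix i j assume ij: "i \<le> j" "j < CARD('k)"
    have "sorted (rev (map (($) a) ys))" by (simp add: ys_def rev_map)
    then have "sorted_wrt (\<ge>) (map (($) a) ys)" by (simp add: sorted_wrt_rev)
    then show "a $ (ys ! j) \<le> a $ (ys ! i)"
      using ij len by (cases "i = j") (auto simp: sorted_wrt_iff_nth_less)
  qed
qed

lemma sum_list_take_map_upt:
  "m \<le> K \<Longrightarrow> sum_list (take m (map f [0..<K])) = sum f {..<m}"
  by (simp add: take_map interv_sum_list_conv_sum_set_nat atLeast0LessThan)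

text \<open>Both vectors are read as decreasing sequences by rank, and ranks are placed back along
  the ordering of \<open>b\<close>. This returns \<open>b\<close> itself and a permutation of
  \<open>a\<close>, which symmetry of \<open>\<Phi>\<close> absorbs.\<close>

lemma schur_concave_on_of_transfer:
  fixes \<Phi> :: "real ^ 'k::finite \<Rightarrow> real"
  assumes sym: "symmetric_fun \<Phi>"
    and transfer: "\<And>p i j \<delta>. (\<And>l. 0 \<le> p $ l) \<Longrightarrow> i \<noteq> j \<Longrightarrow> 0 \<le> \<delta> \<Longrightarrow> p $ i + \<delta> \<le> p $ j - \<delta> \<Longrightarrow>
       \<Phi> p \<le> \<Phi> (set_pair i j p (p $ i + \<delta>) (p $ j - \<delta>))"
  shows "schur_concave_on {p. \<forall>l. 0 \<le> p $ l} \<Phi>"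
  unfolding schur_concave_on_def
proof (intro ballI impI)
  fix a b :: "real ^ 'k"
  assume a: "a \<in> {p. \<forall>l. 0 \<le> p $ l}" and maj: "majorizes a b"
  let ?K = "CARD('k)"
  obtain d where d: "bij_betw d {..<?K} UNIV" "decreasing_coords a = map (\<lambda>i. a $ d i) [0..<?K]"
    using decreasing_coords_enumeration[of a] by blast
  obtain e where e: "bij_betw e {..<?K} UNIV" "decreasing_coords b = map (\<lambda>i. b $ e i) [0..<?K]"
    "\<And>i j. i \<le> j \<Longrightarrow> j < ?K \<Longrightarrow> b $ e j \<le> b $ e i"
    using decreasing_coords_enumeration[of b] by blast
  define h where "h = the_inv_into {..<?K} e"
  have h: "bij_betw h UNIV {..<?K}" unfolding h_def by (rule bij_betw_the_inv_into[OF e(1)])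
  have he: "h (e i) = i" if "i < ?K" for i
    using that e(1) by (auto simp: h_def bij_betw_def the_inv_into_f_f)
  have eh: "e (h l) = l" for l
    using e(1) by (auto simp: h_def bij_betw_def intro!: f_the_inv_into_f)
  have h_less: "h l < ?K" for l using bij_betwE[OF h] by auto
  define vec where "vec \<alpha> = (\<chi> l. \<alpha> (h l))" for \<alpha> :: "nat \<Rightarrow> real"
  have total: "(\<Sum>i<?K. a $ d i) = (\<Sum>j\<in>UNIV. a $ j)" "(\<Sum>i<?K. b $ e i) = (\<Sum>j\<in>UNIV. b $ j)"
    by (rule sum.reindex_bij_betw[OF d(1)], rule sum.reindex_bij_betw[OF e(1)])
  have eq: "(\<Sum>i<?K. b $ e i) = (\<Sum>i<?K. a $ d i)"
    using maj total by (simp add: majorizes_def)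
  have "bij (d \<circ> h)" using h d(1) by (rule bij_betw_trans)
  moreover have "vec (\<lambda>i. a $ d i) = permute_vec (d \<circ> h) a"
    by (simp add: vec_def permute_vec_def)
  ultimately have "\<Phi> a = \<Phi> (vec (\<lambda>i. a $ d i))" using sym by (simp add: symmetric_fun_def)
  also have "\<dots> \<le> \<Phi> (vec (\<lambda>i. b $ e i))"
  proof (rule partial_sums_le_imp_transfer_le[where K = ?K and F = "\<lambda>\<alpha>. \<Phi> (vec \<alpha>)"])
    fix \<alpha> :: "nat \<Rightarrow> real" assume "\<And>l. l < ?K \<Longrightarrow> \<alpha> l = b $ e l"
    then show "\<Phi> (vec \<alpha>) = \<Phi> (vec (\<lambda>l. b $ e l))" using h_less by (simp add: vec_def)
  next
    fix \<alpha> :: "nat \<Rightarrow> real" and i j \<delta>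
    assume *: "\<And>l. l < ?K \<Longrightarrow> 0 \<le> \<alpha> l" "i < j" "j < ?K" "0 \<le> \<delta>" "\<alpha> j + \<delta> \<le> \<alpha> i - \<delta>"
    have v: "vec \<alpha> $ e j = \<alpha> j" "vec \<alpha> $ e i = \<alpha> i" using * he by (simp_all add: vec_def)
    have ne: "e i \<noteq> e j" using * he by (metis less_irrefl less_trans)
    \<comment> \<open>The roles flip: the earlier rank \<open>i\<close> gives and the later rank
      \<open>j\<close> receives, so \<open>e j\<close> is the first argument of
      \<open>set_pair\<close>.\<close>
    have "vec (\<alpha>(i := \<alpha> i - \<delta>, j := \<alpha> j + \<delta>)) =
      set_pair (e j) (e i) (vec \<alpha>) (vec \<alpha> $ e j + \<delta>) (vec \<alpha> $ e i - \<delta>)"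
      unfolding v using * ne he eh by (auto simp: vec_def set_pair_def vec_eq_iff)
    moreover have "\<Phi> (vec \<alpha>) \<le> \<Phi> (set_pair (e j) (e i) (vec \<alpha>) (vec \<alpha> $ e j + \<delta>) (vec \<alpha> $ e i - \<delta>))"
      by (rule transfer) (use * h_less ne v in \<open>auto simp: vec_def[of \<alpha>]\<close>)
    ultimately show "\<Phi> (vec \<alpha>) \<le> \<Phi> (vec (\<alpha>(i := \<alpha> i - \<delta>, j := \<alpha> j + \<delta>)))" by simp
  next
    fix m assume "m \<le> ?K"
    \<comment> \<open>\<open>majorizes\<close> compares only proper prefixes; the full one comes
      from equality of the totals.\<close>
    then consider "m = ?K" | "m < ?K" by linarith
    then show "(\<Sum>i<m. b $ e i) \<le> (\<Sum>i<m. a $ d i)"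
    proof cases
      case 2
      with maj have "sum_list (take m (decreasing_coords b)) \<le> sum_list (take m (decreasing_coords a))"
        by (auto simp: majorizes_def)
      with 2 show ?thesis by (simp add: d(2) e(2) sum_list_take_map_upt)
    qed (simp add: eq)
  qed (use a e(3) eq in auto)
  also have "vec (\<lambda>i. b $ e i) = b" by (simp add: vec_def eh)
  finally show "\<Phi> a \<le> \<Phi> b" .
qed

theorem schur_concave_on_multinomial_expectation:
  fixes \<phi> :: "nat ^ 'k::finite \<Rightarrow> real"
  assumes "symmetric_fun \<phi>" "transfer_mono \<phi>"
  shows "schur_concave_on {p. \<forall>l. 0 \<le> p $ l} (multinomial_expectation n \<phi>)"
  by (intro schur_concave_on_of_transfer symmetric_fun_multinomial_expectation
      multinomial_expectation_transfer assms)

subsection \<open>The statistic\<close>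

text \<open>At \<open>m = 0\<close> the value is 1, because \<open>0 ^ 0 = 1\<close>.\<close>

definition fact_ratio :: "nat \<Rightarrow> real" where
  "fact_ratio m = fact m / real m ^ m"

lemma fact_ratio_pos: "0 < fact_ratio m"
  by (cases "m = 0") (auto simp: fact_ratio_def)

lemma fact_ratio_Suc: "fact_ratio (Suc m) = fact_ratio m * (real m / real (Suc m)) ^ m"
  by (cases "m = 0") (auto simp: fact_ratio_def power_divide)

text \<open>This is log-concavity of \<open>fact_ratio\<close>, whose successive quotients these
  are; equivalently, \<open>(1 + 1/m)^m\<close> increases with \<open>m\<close>.\<close>

lemma decseq_ratio_power: "decseq (\<lambda>m. (real m / real (Suc m)) ^ m)"
proof (rule decseq_SucI)
  fix m
  show "(real (Suc m) / real (Suc (Suc m))) ^ Suc m \<le> (real m / real (Suc m)) ^ m"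
  \<comment> \<open>At \<open>m = 0\<close> the factor \<open>(y - 1) / y\<close>, cancelled below,
    would vanish.\<close>
  proof (cases "m = 0")
    case False
    define y where "y = real (Suc m)"
    have y: "y > 1" using False by (simp add: y_def)
    \<comment> \<open>Bernoulli with exponent \<open>y\<close> gives
      \<open>(1 - 1/y^2)^y \<ge> 1 - 1/y\<close>. Factoring \<open>1 - 1/y^2\<close> as
      \<open>(1 - 1/y) (1 + 1/y)\<close> and cancelling one \<open>1 - 1/y\<close> leaves the claim
      up to rearrangement.\<close>
    have "1 + real (Suc m) * (- 1 / y\<^sup>2) \<le> (1 + (- 1 / y\<^sup>2)) ^ Suc m"
      by (rule Bernoulli_inequality) (use y in \<open>simp add: divide_le_eq_1\<close>)
    also have "1 + real (Suc m) * (- 1 / y\<^sup>2) = (y - 1) / y"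
      using y by (simp add: y_def[symmetric] field_simps power2_eq_square del: of_nat_Suc)
    also have "1 + (- 1 / y\<^sup>2) = ((y - 1) / y) * ((y + 1) / y)"
      using y by (simp add: field_simps power2_eq_square)
    finally have "(y - 1) / y * 1 \<le> ((y - 1) / y) * (((y - 1) / y) ^ m * ((y + 1) / y) ^ Suc m)"
      by (simp only: power_mult_distrib power_Suc mult_ac mult_1_right)
    then have "1 \<le> ((y - 1) / y) ^ m * ((y + 1) / y) ^ Suc m"
      using y by (subst (asm) mult_le_cancel_left_pos) auto
    then have "(y / (y + 1)) ^ Suc m * 1 \<le>
       (y / (y + 1)) ^ Suc m * (((y - 1) / y) ^ m * ((y + 1) / y) ^ Suc m)"
      using y by (intro mult_left_mono) auto
    also have "\<dots> = ((y - 1) / y) ^ m * ((y / (y + 1)) * ((y + 1) / y)) ^ Suc m"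
      by (simp only: power_mult_distrib mult_ac)
    also have "(y / (y + 1)) * ((y + 1) / y) = 1" using y by simp
    finally show ?thesis by (simp add: y_def add_ac)
  qed simp
qed

text \<open>Moving the unit multiplies the product by \<open>r a / r (b - 1)\<close>, at least 1
  since \<open>r\<close> decreases and \<open>a \<le> b - 1\<close>.\<close>

lemma fact_ratio_transfer:
  assumes "a < b"
  shows "fact_ratio a * fact_ratio b \<le> fact_ratio (Suc a) * fact_ratio (b - 1)"
proof -
  define r where "r m = (real m / real (Suc m)) ^ m" for m
  obtain b' where b: "b = Suc b'" "a \<le> b'" using assms by (cases b) auto
  have "r b' \<le> r a" using decseq_ratio_power b(2) unfolding r_def by (rule decseqD)
  then have "(fact_ratio a * fact_ratio b') * r b' \<le> (fact_ratio a * fact_ratio b') * r a"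
    using fact_ratio_pos by (intro mult_left_mono) (auto simp: less_imp_le)
  moreover have "fact_ratio (Suc m) = fact_ratio m * r m" for m
    by (simp only: fact_ratio_Suc r_def)
  ultimately show ?thesis by (simp add: b mult_ac)
qed

section \<open>Symmetry and transfer monotonicity of the statistic\<close>

lemma L_stat_eq_prod_fact_ratio: "L_stat x = (\<Prod>j\<in>UNIV. fact_ratio (x $ j))"
  by (simp add: L_stat_def fact_ratio_def)

lemma symmetric_fun_L_stat: "symmetric_fun L_stat"
  unfolding symmetric_fun_def
proof (intro allI impI)
  fix \<pi> :: "'a \<Rightarrow> 'a" and x assume "bij \<pi>"
  then have "(\<Prod>j\<in>UNIV. fact_ratio (x $ \<pi> j)) = (\<Prod>j\<in>UNIV. fact_ratio (x $ j))"
    by (rule prod.reindex_bij_betw)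
  then show "L_stat (permute_vec \<pi> x) = L_stat x"
    by (simp add: L_stat_eq_prod_fact_ratio permute_vec_def)
qed

lemma L_stat_transfer:
  assumes "i \<noteq> j" "x $ i < x $ j"
  shows "L_stat x \<le> L_stat (set_pair i j x (Suc (x $ i)) (x $ j - 1))"
proof -
  let ?y = "set_pair i j x (Suc (x $ i)) (x $ j - 1)"
  have split: "L_stat z = fact_ratio (z $ i) * fact_ratio (z $ j) * (\<Prod>l\<in>UNIV - {i, j}. fact_ratio (z $ l))" for z
    unfolding L_stat_eq_prod_fact_ratio
    by (subst prod.remove_pair[OF finite_class.finite_UNIV UNIV_I UNIV_I assms(1)]) simp
  have "(\<Prod>l\<in>UNIV - {i, j}. fact_ratio (?y $ l)) = (\<Prod>l\<in>UNIV - {i, j}. fact_ratio (x $ l))"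
    by (auto intro!: prod.cong)
  then show ?thesis
    unfolding split using assms fact_ratio_transfer[OF assms(2)]
    by (auto intro!: mult_right_mono prod_nonneg simp: fact_ratio_pos less_imp_le)
qed

theorem proposition4p2:
  fixes n :: nat and c :: real
  assumes "n \<ge> 1"
  shows "schur_concave_on (prob_simplex :: (real ^ 'k::finite) set)
           (\<lambda>p. measure_pmf.prob (multinomial_pmf n p) {x \<in> compositions n. L_stat x \<ge> c})"
proof -
  define \<phi> :: "nat ^ 'k \<Rightarrow> real" where "\<phi> x = (if L_stat x \<ge> c then 1 else 0)" for x
  have "symmetric_fun \<phi>"
    using symmetric_fun_L_stat by (auto simp: symmetric_fun_def \<phi>_def)
  \<comment> \<open>A transfer never lowers \<open>L_stat\<close>, so it cannot leave the set where
    \<open>L_stat x \<ge> c\<close>.\<close>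
  moreover have "transfer_mono \<phi>"
    unfolding transfer_mono_def \<phi>_def using L_stat_transfer order_trans by (smt (verit))
  ultimately have "schur_concave_on {p. \<forall>l. 0 \<le> p $ l} (multinomial_expectation n \<phi>)"
    by (rule schur_concave_on_multinomial_expectation)
  moreover have "measure_pmf.prob (multinomial_pmf n p) {x \<in> compositions n. L_stat x \<ge> c}
      = multinomial_expectation n \<phi> p" if "p \<in> prob_simplex" for p :: "real ^ 'k"
  proof -
    have "measure_pmf.prob (multinomial_pmf n p) {x \<in> compositions n. L_stat x \<ge> c}
      = (\<Sum>x | x \<in> compositions n \<and> L_stat x \<ge> c. multinomial_density n p x)"
      using that by (subst measure_measure_pmf_finite) (auto simp: finite_compositions pmf_multinomial)
    also have "\<dots> = multinomial_expectation n \<phi> p"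
      unfolding multinomial_expectation_def
      by (rule sum.mono_neutral_cong_left) (auto simp: finite_compositions \<phi>_def)
    finally show ?thesis .
  qed
  \<comment> \<open>The simplex lies in the nonnegative orthant, so Schur-concavity restricts to
    it.\<close>
  ultimately show ?thesis
    by (auto simp: schur_concave_on_def prob_simplex_def)
qed

end
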